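(* Let $m$ be a positive integer, let $n\in\{2m,2m+1\}$, and let $F(x)=x^{2^{m+1}-1}$ be the power mapping on $\mathbb{F}_{2^n}$. For $(a,c,b,d)\in\mathbb{F}_{2^n}^4$ put $t_1=\frac{c}{a^{2^{m+1}-1}}$ when $a\neq 0$ and $t_2=\frac{d}{b^{2^{m+1}-1}}$ when $b\neq 0$. (i) If $n=2m+1$, then $$\mathrm{FBET}_F(a,c,b,d)=\begin{cases}2^n,&\text{if }(a,c,b,d)\in I_{2^n};\\ 2,&\text{if }(a,c,b,d)\in I_2^{(1)}\cup I_2^{(2)}\cup I_2^{(3)};\\ 0,&\text{otherwise},\end{cases}$$ where \begin{align*} I_{2^n}&=\{(a,c,b,d)\in\mathbb{F}_{2^n}^4: a=c=b=d=0\},\\ I_2^{(1)}&=\{(a,c,b,d)\in\mathbb{F}_{2^n}^4: a=c=0,\ bd\neq 0\text{ and }\mathrm{Tr}_1^n\left(\tfrac{1}{t_2^{2^m+1}}\right)=1\},\\ I_2^{(2)}&=\{(a,c,b,d)\in\mathbb{F}_{2^n}^4: a\neq 0,\ c\neq 0,\ b=d=0\text{ and }\mathrm{Tr}_1^n\left(\tfrac{1}{t_1^{2^m+1}}\right)=1\},\\ I_2^{(3)}&=\{(a,c,b,d)\in\mathbb{F}_{2^n}^4: a=b\neq 0,\ c=d\neq 0\text{ and }\mathrm{Tr}_1^n\left(\tfrac{1}{t_1^{2^m+1}}\right)=1\}. \end{align*} (ii) If $n=2m$, then $$\mathrm{FBET}_F(a,c,b,d)=\begin{cases}2^n,&\text{if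 }(a,c,b,d)\in I_{2^n};\\ 2^m,&\text{if }(a,c,b,d)\in I_{2^m}^{(1)}\cup I_{2^m}^{(2)}\cup I_{2^m}^{(3)}\cup I_{2^m}^{(4)};\\ 2,&\text{if }(a,c,b,d)\in I_2^{(1)}\cup I_2^{(2)}\cup I_2^{(3)}\cup I_2^{(4)}\cup I_2^{(5)}\cup I_2^{(6)};\\ 0,&\text{otherwise},\end{cases}$$ where \begin{align*} I_{2^n}&=\{(a,c,b,d)\in\mathbb{F}_{2^n}^4: a=c=b=d=0\},\\ I_{2^m}^{(1)}&=\{(a,c,b,d)\in\mathbb{F}_{2^n}^4: a=c=0,\ bd\neq 0\text{ and }t_2=1\},\\ I_{2^m}^{(2)}&=\{(a,c,b,d)\in\mathbb{F}_{2^n}^4: a\neq 0,\ c\neq 0,\ b=d=0\text{ and }t_1=1\},\\ I_{2^m}^{(3)}&=\{(a,c,b,d)\in\mathbb{F}_{2^n}^4: a=b\neq 0,\ c=d\neq 0\text{ and }t_1=1\},\\ I_{2^m}^{(4)}&=\{(a,c,b,d)\in\mathbb{F}_{2^n}^4: a\neq 0,\ b\notin\{0,a\},\ \tfrac{a}{b}\in\mathbb{F}_{2^m}\setminus\{0,1\},\ t_1=1\text{ and }t_2=1\},\\ I_2^{(1)}&=\{(a,c,b,d)\in\mathbb{F}_{2^n}^4: a=c=0,\ bd\neq 0,\ t_2^{2^m+1}\neq 1\text{ and }\mathrm{Tr}_1^m\left(\tfrac{t_2^{2^m}+t_2+1}{t_2^{2^{m+1}+2}+1}\right)=1\},\\ I_2^{(2)}&=\{(a,c,b,d)\in\mathbb{F}_{2^n}^4: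 a=c=0,\ b\neq 0,\ d=0\text{ and }m\text{ is odd}\},\\ I_2^{(3)}&=\{(a,c,b,d)\in\mathbb{F}_{2^n}^4: a\neq 0,\ c\neq 0,\ b=d=0,\ t_1^{2^m+1}\neq 1\text{ and }\mathrm{Tr}_1^m\left(\tfrac{t_1^{2^m}+t_1+1}{t_1^{2^{m+1}+2}+1}\right)=1\},\\ I_2^{(4)}&=\{(a,c,b,d)\in\mathbb{F}_{2^n}^4: a\neq 0,\ c=0,\ b=d=0\text{ and }m\text{ is odd}\},\\ I_2^{(5)}&=\{(a,c,b,d)\in\mathbb{F}_{2^n}^4: a=b\neq 0,\ c=d\neq 0,\ t_1^{2^m+1}\neq 1\text{ and }\mathrm{Tr}_1^m\left(\tfrac{t_1^{2^m}+t_1+1}{t_1^{2^{m+1}+2}+1}\right)=1\},\\ I_2^{(6)}&=\{(a,c,b,d)\in\mathbb{F}_{2^n}^4: a=b\neq 0,\ c=d=0\text{ and }m\text{ is odd}\}. \end{align*}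
   Context: $\mathbb{F}_{2^n}$ is the finite field with $2^n$ elements. For a positive integer $k$, $\mathrm{Tr}_1^k(x)=\sum_{i=0}^{k-1}x^{2^i}$ is the absolute trace from $\mathbb{F}_{2^k}$ to $\mathbb{F}_2$. When $n=2m$, $\mathbb{F}_{2^m}$ is regarded as the subfield of $\mathbb{F}_{2^n}$ of order $2^m$, and the arguments to which $\mathrm{Tr}_1^m$ is applied lie in this subfield. For a mapping $F:\mathbb{F}_{2^n}\to\mathbb{F}_{2^n}$ and $(a,c,b,d)\in\mathbb{F}_{2^n}^4$, the Feistel Boomerang Extended Table (FBET) entry is $$\mathrm{FBET}_F(a,c,b,d)=|\{x\in\mathbb{F}_{2^n}: F(x)+F(x+a)+F(x+b)+F(x+a+b)=0,\ F(x)+F(x+a)=c,\ F(x+a)+F(x+a+b)=d\}|.$$ *)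

theory Defs
  imports "HOL-Library.Cardinality" "HOL-Algebra.Algebraic_Closure_Type"
begin

definition FBET :: "('a::finite_field \<Rightarrow> 'a) \<Rightarrow> 'a \<Rightarrow> 'a \<Rightarrow> 'a \<Rightarrow> 'a \<Rightarrow> nat" where
  "FBET F a c b d =
     card {x. F x + F (x + a) + F (x + b) + F (x + a + b) = 0 \<and>
              F x + F (x + a) = c \<and>
              F (x + a) + F (x + a + b) = d}"

text \<open>
  The trace to the prime field. On the field of order \<open>2 ^ k\<close> this is the absolute trace. For a
  proper subfield of order \<open>2 ^ k\<close> it is evaluated inside the ambient field.
\<close>

definition abs_trace :: "nat \<Rightarrow> 'a::finite_field \<Rightarrow> 'a" where
  "abs_trace k x = (\<Sum>i<k. x ^ (2 ^ i))"

definition subfield_of_order :: "nat \<Rightarrow> 'a::finite_field set" where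
  "subfield_of_order q =
     (THE K. subfield K (ring_of_type_algebra :: 'a ring) \<and> card K = q)"

definition power_map :: "nat \<Rightarrow> 'a::finite_field \<Rightarrow> 'a" where
  "power_map m x = x ^ (2 ^ (m + 1) - 1)"

text \<open>
  \<open>tq m a c\<close> is \<open>t\<^sub>1\<close> and \<open>tq m b d\<close> is \<open>t\<^sub>2\<close>. It is meaningful only for a nonzero first argument
  (\<open>a\<close> or \<open>b\<close>), which every set below that uses it demands.
\<close>

definition tq :: "nat \<Rightarrow> 'a::finite_field \<Rightarrow> 'a \<Rightarrow> 'a" where
  "tq m a c = c / a ^ (2 ^ (m + 1) - 1)"

definition I_zero :: "('a::finite_field \<times> 'a \<times> 'a \<times> 'a) set" where
  "I_zero = {(a, c, b, d). a = 0 \<and> c = 0 \<and> b = 0 \<and> d = 0}"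


subsection \<open>Extension degree \<open>n = 2 * m + 1\<close>\<close>

definition odd_I2_1 :: "nat \<Rightarrow> nat \<Rightarrow> ('a::finite_field \<times> 'a \<times> 'a \<times> 'a) set" where
  "odd_I2_1 n m = {(a, c, b, d). a = 0 \<and> c = 0 \<and> b * d \<noteq> 0 \<and>
     abs_trace n (1 / tq m b d ^ (2 ^ m + 1)) = 1}"

definition odd_I2_2 :: "nat \<Rightarrow> nat \<Rightarrow> ('a::finite_field \<times> 'a \<times> 'a \<times> 'a) set" where
  "odd_I2_2 n m = {(a, c, b, d). a \<noteq> 0 \<and> c \<noteq> 0 \<and> b = 0 \<and> d = 0 \<and>
     abs_trace n (1 / tq m a c ^ (2 ^ m + 1)) = 1}"

definition odd_I2_3 :: "nat \<Rightarrow> nat \<Rightarrow> ('a::finite_field \<times> 'a \<times> 'a \<times> 'a) set" where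
  "odd_I2_3 n m = {(a, c, b, d). a = b \<and> b \<noteq> 0 \<and> c = d \<and> d \<noteq> 0 \<and>
     abs_trace n (1 / tq m a c ^ (2 ^ m + 1)) = 1}"


subsection \<open>Extension degree \<open>n = 2 * m\<close>\<close>

definition even_Im_1 :: "nat \<Rightarrow> ('a::finite_field \<times> 'a \<times> 'a \<times> 'a) set" where
  "even_Im_1 m = {(a, c, b, d). a = 0 \<and> c = 0 \<and> b * d \<noteq> 0 \<and> tq m b d = 1}"

definition even_Im_2 :: "nat \<Rightarrow> ('a::finite_field \<times> 'a \<times> 'a \<times> 'a) set" where
  "even_Im_2 m = {(a, c, b, d). a \<noteq> 0 \<and> c \<noteq> 0 \<and> b = 0 \<and> d = 0 \<and> tq m a c = 1}"

definition even_Im_3 :: "nat \<Rightarrow> ('a::finite_field \<times> 'a \<times> 'a \<times> 'a) set" where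
  "even_Im_3 m = {(a, c, b, d). a = b \<and> b \<noteq> 0 \<and> c = d \<and> d \<noteq> 0 \<and> tq m a c = 1}"

definition even_Im_4 :: "nat \<Rightarrow> ('a::finite_field \<times> 'a \<times> 'a \<times> 'a) set" where
  "even_Im_4 m = {(a, c, b, d). a \<noteq> 0 \<and> b \<notin> {0, a} \<and>
     a / b \<in> subfield_of_order (2 ^ m) - {0, 1} \<and> tq m a c = 1 \<and> tq m b d = 1}"

definition even_trace_cond :: "nat \<Rightarrow> 'a::finite_field \<Rightarrow> bool" where
  "even_trace_cond m t \<longleftrightarrow> t ^ (2 ^ m + 1) \<noteq> 1 \<and>
     abs_trace m ((t ^ (2 ^ m) + t + 1) / (t ^ (2 ^ (m + 1) + 2) + 1)) = 1"

definition even_I2_1 :: "nat \<Rightarrow> ('a::finite_field \<times> 'a \<times> 'a \<times> 'a) set" where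
  "even_I2_1 m = {(a, c, b, d). a = 0 \<and> c = 0 \<and> b * d \<noteq> 0 \<and> even_trace_cond m (tq m b d)}"

definition even_I2_2 :: "nat \<Rightarrow> ('a::finite_field \<times> 'a \<times> 'a \<times> 'a) set" where
  "even_I2_2 m = {(a, c, b, d). a = 0 \<and> c = 0 \<and> b \<noteq> 0 \<and> d = 0 \<and> odd m}"

definition even_I2_3 :: "nat \<Rightarrow> ('a::finite_field \<times> 'a \<times> 'a \<times> 'a) set" where
  "even_I2_3 m = {(a, c, b, d). a \<noteq> 0 \<and> c \<noteq> 0 \<and> b = 0 \<and> d = 0 \<and> even_trace_cond m (tq m a c)}"

definition even_I2_4 :: "nat \<Rightarrow> ('a::finite_field \<times> 'a \<times> 'a \<times> 'a) set" where
  "even_I2_4 m = {(a, c, b, d). a \<noteq> 0 \<and> c = 0 \<and> b = 0 \<and> d = 0 \<and> odd m}"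

definition even_I2_5 :: "nat \<Rightarrow> ('a::finite_field \<times> 'a \<times> 'a \<times> 'a) set" where
  "even_I2_5 m = {(a, c, b, d). a = b \<and> b \<noteq> 0 \<and> c = d \<and> d \<noteq> 0 \<and> even_trace_cond m (tq m a c)}"

definition even_I2_6 :: "nat \<Rightarrow> ('a::finite_field \<times> 'a \<times> 'a \<times> 'a) set" where
  "even_I2_6 m = {(a, c, b, d). a = b \<and> b \<noteq> 0 \<and> c = 0 \<and> d = 0 \<and> odd m}"


subsection \<open>The subfield of order \<open>2 ^ m\<close> is well defined\<close>

lemma ring_of_type_simps [simp]:
  "carrier (ring_of_type_algebra :: 'a::finite_field ring) = UNIV"
  "x \<otimes>\<^bsub>(ring_of_type_algebra :: 'a ring)\<^esub> y = x * y"
  "x \<oplus>\<^bsub>(ring_of_type_algebra :: 'a ring)\<^esub> y = x + y"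
  "\<one>\<^bsub>(ring_of_type_algebra :: 'a ring)\<^esub> = 1"
  "\<zero>\<^bsub>(ring_of_type_algebra :: 'a ring)\<^esub> = 0"
  by (simp_all add: ring_of_type_algebra_def)

lemma card_power_eq_le:
  fixes y :: "'a::finite_field"
  assumes "k > 0"
  shows "card {x::'a. x ^ k = y} \<le> k"
proof -
  define p where "p = monom (1::'a) k - [:y:]"
  have "coeff p k = 1"
    using assms by (cases k) (auto simp: p_def coeff_pCons)
  hence "p \<noteq> 0" by auto
  have "degree p \<le> k"
    unfolding p_def by (rule degree_diff_le) (auto simp: degree_monom_le)
  have "{x. x ^ k = y} = {x. poly p x = 0}"
    by (auto simp: p_def poly_monom)
  thus ?thesis
    using card_poly_roots_bound[OF \<open>p \<noteq> 0\<close>] \<open>degree p \<le> k\<close> by simp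
qed

lemma subfield_power_card:
  fixes K :: "'a::finite_field set"
  assumes "subfield K (ring_of_type_algebra :: 'a ring)" and "x \<in> K"
  shows "x ^ card K = x"
proof (cases "x = 0")
  case True
  have "card K > 0" using assms(2) by (auto simp: card_gt_0_iff)
  thus ?thesis using True by simp
next
  case False
  let ?R = "ring_of_type_algebra :: 'a ring"
  interpret R: field ?R by (rule field_from_type_algebra)
  note sub = R.subring_props[OF assms(1)]
  have inj: "inj_on ((*) x) (K - {0})" using False by (auto simp: inj_on_def)
  have img: "(*) x ` (K - {0}) = K - {0}"
  proof (rule endo_inj_surj[OF _ _ inj])
    show "(*) x ` (K - {0}) \<subseteq> K - {0}"
      using sub(6)[OF assms(2)] False by auto
  qed auto
  have "\<Prod>(K - {0}) = (\<Prod>y\<in>K - {0}. x * y)"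
    using prod.reindex[OF inj, of "\<lambda>y. y"] img by (simp add: comp_def)
  also have "\<dots> = x ^ (card K - 1) * \<Prod>(K - {0})"
    using sub(2) by (simp add: prod.distrib)
  finally have "x ^ (card K - 1) = 1" by simp
  moreover have "card K > 0" using assms(2) by (auto simp: card_gt_0_iff)
  ultimately show ?thesis
    by (metis Suc_pred' mult.right_neutral power_Suc)
qed

lemma CHAR_eq_2:
  assumes "CARD('a::finite_field) = 2 ^ n"
  shows "CHAR('a) = 2"
proof -
  have pr: "prime CHAR('a)"
    by (rule prime_CHAR_semidom) (rule finite_imp_CHAR_pos, simp)
  have "(\<Sum>x\<in>UNIV. x) = (\<Sum>x\<in>UNIV. x + (1::'a))"
    by (rule sum.reindex_bij_witness[of _ "\<lambda>x. x + 1" "\<lambda>x. x - 1"]) auto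
  hence "of_nat CARD('a) = (0::'a)" by (simp add: sum.distrib)
  hence "CHAR('a) dvd CARD('a)" by (simp only: of_nat_eq_0_iff_char_dvd)
  thus ?thesis
    using assms pr by (metis primes_dvd_imp_eq prime_dvd_power two_is_prime_nat)
qed

lemma subfield_fixed_points:
  assumes "CARD('a::finite_field) = 2 ^ n"
  shows "subfield {x::'a. x ^ (2 ^ m) = x} (ring_of_type_algebra :: 'a ring)"
proof -
  let ?R = "ring_of_type_algebra :: 'a ring"
  interpret R: field ?R by (rule field_from_type_algebra)
  have char: "CHAR('a) = 2" by (rule CHAR_eq_2[OF assms])
  have add: "(x + y) ^ (2 ^ m) = x ^ (2 ^ m) + y ^ (2 ^ m)" for x y :: 'a
    by (rule freshmans_dream') (simp_all add: char)
  have two: "x + x = 0" for x :: 'a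
    by (metis char of_nat_CHAR mult_2 mult_zero_left of_nat_numeral)
  have neg: "\<ominus>\<^bsub>?R\<^esub> x = x" for x :: 'a
    by (rule R.minus_equality) (simp_all add: two)
  have inv: "inv\<^bsub>?R\<^esub> x = inverse x" if "x \<noteq> 0" for x :: 'a
    by (rule R.comm_inv_char) (simp_all add: that)
  show ?thesis
    by (rule R.subfieldI', rule R.subringI)
       (auto simp: neg inv add power_mult_distrib power_inverse)
qed

lemma card_fixed_points:
  assumes "CARD('a::finite_field) = 2 ^ (2 * m)" and "m \<ge> 1"
  shows "card {x::'a. x ^ (2 ^ m) = x} = 2 ^ m"
proof -
  define q :: nat where "q = 2 ^ m"
  have q: "q \<ge> 2" using assms(2) self_le_power[of "2::nat" m] by (simp add: q_def)
  have cardq: "CARD('a) = q * q" using assms(1) by (simp add: q_def mult_2 power_add)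
  define U where "U = {x::'a. x ^ (q - 1) = 1}"
  have fix_eq: "{x::'a. x ^ q = x} = insert 0 U"
  proof -
    have "x ^ q = x \<longleftrightarrow> x = 0 \<or> x ^ (q - 1) = 1" for x :: 'a
      using q power_Suc[of x "q - 1"] by (cases "x = 0") auto
    thus ?thesis by (auto simp: U_def)
  qed
  have card_fix: "card {x::'a. x ^ q = x} = Suc (card U)"
    using q unfolding fix_eq by (simp add: U_def zero_power)
  have "card U \<le> q - 1" unfolding U_def using q by (intro card_power_eq_le) simp
  have pow: "x ^ (q + 1) \<in> U" if "x \<noteq> 0" for x :: 'a
  proof -
    have "x * x ^ (q * q - 1) = x"
      using finite_field_power_card_eq_same[of x] cardq q power_Suc[of x "q * q - 1"] by simp
    hence "x ^ (q * q - 1) = 1" using that by simp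
    moreover have "(q + 1) * (q - 1) = q * q - 1"
      by (simp add: algebra_simps diff_mult_distrib2)
    ultimately have "(x ^ (q + 1)) ^ (q - 1) = 1" by (simp only: power_mult[symmetric])
    thus ?thesis by (simp only: U_def mem_Collect_eq)
  qed
  have "UNIV - {0::'a} \<subseteq> (\<Union>y\<in>U. {x. x ^ (q + 1) = y})" using pow by auto
  hence "card (UNIV - {0::'a}) \<le> card (\<Union>y\<in>U. {x::'a. x ^ (q + 1) = y})"
    by (intro card_mono) auto
  also have "\<dots> \<le> (\<Sum>y\<in>U. card {x::'a. x ^ (q + 1) = y})"
    by (rule card_UN_le) simp
  also have "\<dots> \<le> (\<Sum>y\<in>U. q + 1)"
    by (intro sum_mono card_power_eq_le) simp
  finally have "q * q - 1 \<le> card U * (q + 1)" by (simp add: cardq)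
  moreover have "q * q - 1 = (q - 1) * (q + 1)"
    by (simp add: algebra_simps diff_mult_distrib2)
  ultimately have "q - 1 \<le> card U" by (metis mult_le_cancel2 add_gr_0 zero_less_one)
  with \<open>card U \<le> q - 1\<close> card_fix q show ?thesis by (simp add: q_def)
qed

lemma subfield_of_order_eq:
  assumes "CARD('a::finite_field) = 2 ^ (2 * m)" and "m \<ge> 1"
  shows "subfield_of_order (2 ^ m) = {x::'a. x ^ (2 ^ m) = x}"
  unfolding subfield_of_order_def
proof (rule the_equality)
  fix K assume K: "subfield K (ring_of_type_algebra :: 'a ring) \<and> card K = 2 ^ m"
  show "K = {x. x ^ (2 ^ m) = x}"
  proof (rule card_subset_eq)
    show "K \<subseteq> {x. x ^ (2 ^ m) = x}" using K subfield_power_card[of K] by auto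
    show "card K = card {x::'a. x ^ (2 ^ m) = x}" using K card_fixed_points[OF assms] by simp
  qed simp
qed (use subfield_fixed_points[OF assms(1)] card_fixed_points[OF assms] in auto)

end

(*
  FBET entries with a = 0, b = 0 or a = b are differential counts |{x. F x + F (x + a) = c}|. In all
  other cases x, x + a, x + b, x + a + b are four distinct solutions of F x + F (x + a) = c, so only
  the few differential equations with more than two solutions contribute. After scaling to a = 1
  and clearing denominators the differential equation is x^(2^(m+1)) + x = t (x^2 + x), which is
  solved explicitly up to an Artin-Schreier equation, whence the trace conditions.
*)
theory Submission
  imports Defs
begin

section \<open>Characteristic two: Frobenius powers, traces and Artin-Schreier equations\<close>

definition diff_count :: "('a::finite_field \<Rightarrow> 'a) \<Rightarrow> 'a \<Rightarrow> 'a \<Rightarrow> nat" where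
  "diff_count F a c = card {x. F x + F (x + a) = c}"

locale binary_field =
  fixes n :: nat and ty :: "'a::finite_field itself"
  assumes card_field: "CARD('a) = 2 ^ n"
begin

lemma char_two: "CHAR('a) = 2"
  by (rule CHAR_eq_2[OF card_field])

lemma two_eq_0 [simp]: "(2::'a) = 0"
  by (metis char_two of_nat_CHAR of_nat_numeral)

lemma add_self [simp]: "x + x = (0::'a)"
  by (metis mult_2 mult_zero_left two_eq_0)

lemma add_self_left [simp]: "x + (x + y) = (y::'a)"
  by (simp flip: add.assoc)

lemma add_eq_iff: "x + y = z \<longleftrightarrow> x = y + (z::'a)"
  by (metis add.commute add_self_left)

lemma add_eq_0_iff_eq: "x + y = 0 \<longleftrightarrow> x = (y::'a)"
  by (simp add: add_eq_iff)

lemma frobenius_add: "(x + y) ^ (2 ^ k) = x ^ (2 ^ k) + (y::'a) ^ (2 ^ k)"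
  by (rule freshmans_dream') (simp_all add: char_two)

lemma square_add: "(x + y)\<^sup>2 = x\<^sup>2 + (y::'a)\<^sup>2"
  using frobenius_add[of x y 1] by simp

lemma frobenius_card: "x ^ (2 ^ n) = (x::'a)"
  using finite_field_power_card_eq_same[of x] by (simp add: card_field)

lemma n_pos: "n > 0"
proof (rule ccontr)
  assume "\<not> n > 0"
  hence "CARD('a) = 1" using card_field by simp
  then obtain x :: 'a where "UNIV = {x}" by (auto simp: card_1_singleton_iff)
  hence "(0::'a) = 1" by (metis UNIV_I singletonD)
  thus False by simp
qed

lemma square_eq_self_iff: "x\<^sup>2 = x \<longleftrightarrow> x = 0 \<or> x = (1::'a)"
  by (auto simp: power2_eq_square)

lemma abs_trace_add: "abs_trace k (x + y) = abs_trace k x + abs_trace k (y::'a)"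
  by (simp add: abs_trace_def frobenius_add sum.distrib)

text \<open>The sum telescopes. With \<open>k = n\<close> it vanishes; with \<open>k\<close> half
  the degree it is the relative trace of \<open>x\<close>.\<close>

lemma abs_trace_square_add_self: "abs_trace k (x\<^sup>2 + x) = x ^ (2 ^ k) + (x::'a)"
proof (induction k)
  case (Suc k)
  have "abs_trace (Suc k) (x\<^sup>2 + x) = abs_trace k (x\<^sup>2 + x) + (x\<^sup>2 + x) ^ (2 ^ k)"
    by (simp add: abs_trace_def)
  also have "(x\<^sup>2 + x) ^ (2 ^ k) = x ^ (2 ^ Suc k) + x ^ (2 ^ k)"
    by (simp add: frobenius_add flip: power_mult)
  finally show ?case using Suc by (simp add: add_ac)
qed (simp add: abs_trace_def)

text \<open>Elements \<open>u^2 + u\<close> have trace zero over the full degree, so squaring once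
  more never changes the trace.\<close>

lemma abs_trace_frobenius: "abs_trace n (x ^ (2 ^ k)) = abs_trace n (x::'a)"
proof (induction k)
  case (Suc k)
  have "abs_trace n ((x ^ (2 ^ k))\<^sup>2 + x ^ (2 ^ k)) = 0"
    by (simp add: abs_trace_square_add_self frobenius_card)
  moreover have "x ^ (2 ^ Suc k) = (x ^ (2 ^ k))\<^sup>2"
    by (simp add: mult.commute flip: power_mult)
  ultimately show ?case using Suc by (simp add: abs_trace_add add_eq_0_iff_eq)
qed simp

text \<open>The upper half of the summands is the image of the lower half under the
  \<open>k\<close>-th Frobenius power.\<close>

lemma abs_trace_double:
  "abs_trace (2 * k) x = abs_trace k x + abs_trace k (x::'a) ^ (2 ^ k)"
proof -
  have "abs_trace k x ^ (2 ^ k) = (\<Sum>i<k. x ^ (2 ^ (k + i)))"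
  proof -
    have "(\<Sum>i<j. f i) ^ (2 ^ k) = (\<Sum>i<j. f i ^ (2 ^ k))" for j and f :: "nat \<Rightarrow> 'a"
      by (induction j) (simp_all add: frobenius_add)
    thus ?thesis
      by (simp add: abs_trace_def power_add mult.commute flip: power_mult)
  qed
  moreover have "(\<Sum>i<k + j. f i) = (\<Sum>i<k. f i) + (\<Sum>i<j. f (k + i))" for j and f :: "nat \<Rightarrow> 'a"
    by (induction j) (simp_all add: add_ac)
  ultimately show ?thesis by (simp add: abs_trace_def mult_2)
qed

text \<open>The trace is a nonzero polynomial of degree at most \<open>2 ^ (n - 1)\<close>, which
  bounds its number of roots.\<close>

lemma card_abs_trace_kernel_le: "card {x::'a. abs_trace n x = 0} \<le> 2 ^ (n - 1)"
proof -
  define p :: "'a poly" where "p = (\<Sum>i<n. monom 1 (2 ^ i))"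
  have "coeff p (2 ^ (n - 1)) = (\<Sum>i<n. if i = n - 1 then 1 else 0)"
    unfolding p_def coeff_sum by (intro sum.cong) auto
  also have "\<dots> = 1" using n_pos by simp
  finally have "p \<noteq> 0" by auto
  have "degree p \<le> 2 ^ (n - 1)"
    unfolding p_def
  proof (rule degree_sum_le)
    fix i assume "i \<in> {..<n}"
    hence "(2::nat) ^ i \<le> 2 ^ (n - 1)" by (intro power_increasing) auto
    thus "degree (monom (1::'a) (2 ^ i)) \<le> 2 ^ (n - 1)" by (simp add: degree_monom_eq)
  qed simp
  moreover have "{x. abs_trace n x = 0} = {x. poly p x = 0}"
    by (simp add: p_def abs_trace_def poly_sum poly_monom)
  ultimately show ?thesis using card_poly_roots_bound[OF \<open>p \<noteq> 0\<close>] by simp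
qed

text \<open>The hypothesis says that \<open>x ^ (2 ^ k) + x\<close> is additive with kernel
  \<open>{0, 1}\<close>, so every nonempty fibre has two elements and the image has at least
  \<open>2 ^ (n - 1)\<close>. The image lies in the trace kernel, which is no larger, so the two
  coincide.\<close>

lemma card_artin_schreier:
  assumes fixed: "\<And>x::'a. x ^ (2 ^ k) = x \<Longrightarrow> x = 0 \<or> x = 1"
  shows "card {x::'a. x ^ (2 ^ k) + x = z} = (if abs_trace n z = 0 then 2 else 0)"
proof -
  define f :: "'a \<Rightarrow> 'a" where "f x = x ^ (2 ^ k) + x" for x
  have fibre: "{x. f x = f y} = {y, y + 1}" for y
  proof -
    have "f x = f y \<longleftrightarrow> x + y = 0 \<or> x + y = 1" for x
    proof -
      have "f x = f y \<longleftrightarrow> f x + f y = 0" by (simp add: add_eq_0_iff_eq)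
      also have "f x + f y = (x + y) ^ (2 ^ k) + (x + y)"
        by (simp add: f_def frobenius_add add_ac)
      also have "\<dots> = 0 \<longleftrightarrow> x + y = 0 \<or> x + y = 1"
        using fixed[of "x + y"] by (auto simp: add_eq_0_iff_eq)
      finally show ?thesis .
    qed
    thus ?thesis by (auto simp: add_eq_iff)
  qed
  have card_fibre: "card {x. f x = f y} = 2" for y by (simp add: fibre)
  have "(\<Union>y\<in>range f. {x. f x = y}) = UNIV" by auto
  hence "2 ^ n = card (\<Union>y\<in>range f. {x. f x = y})" by (simp only: card_field)
  also have "\<dots> \<le> (\<Sum>y\<in>range f. card {x. f x = y})" by (rule card_UN_le) simp
  also have "\<dots> = (\<Sum>y\<in>range f. 2)" by (intro sum.cong) (auto simp: card_fibre)
  finally have "2 ^ n \<le> 2 * card (range f)" by simp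
  hence "2 ^ (n - 1) \<le> card (range f)" using n_pos by (cases n) auto
  hence "card {x::'a. abs_trace n x = 0} \<le> card (range f)"
    using card_abs_trace_kernel_le by linarith
  moreover have "range f \<subseteq> {x. abs_trace n x = 0}"
    by (auto simp: f_def abs_trace_add abs_trace_frobenius)
  ultimately have range: "range f = {x. abs_trace n x = 0}"
    by (intro card_seteq) auto
  show ?thesis
  proof (cases "abs_trace n z = 0")
    case True
    then obtain y where "z = f y" using range by (metis (mono_tags) imageE mem_Collect_eq)
    thus ?thesis using True card_fibre[of y] by (simp add: f_def)
  next
    case False
    hence "f x \<noteq> z" for x using range by blast
    thus ?thesis using False by (simp add: f_def)
  qed
qed

section \<open>Reduction of FBET entries to derivatives\<close>

lemma FBET_zero_left: "FBET F 0 c b d = (if c = (0::'a) then diff_count F b d else 0)"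
  by (simp add: FBET_def diff_count_def add_ac)

lemma FBET_zero_right: "FBET F a c 0 d = (if d = (0::'a) then diff_count F a c else 0)"
  by (simp add: FBET_def diff_count_def add_ac)

lemma FBET_diag: "FBET F a c a d = (if c = (d::'a) then diff_count F a c else 0)"
proof -
  have "{x. F x + F (x + a) + F (x + a) + F (x + a + a) = 0 \<and> F x + F (x + a) = c \<and>
          F (x + a) + F (x + a + a) = d} = {x. F x + F (x + a) = c \<and> c = d}"
    by (auto simp: add.assoc add.commute[of "F (_ + a)"])
  thus ?thesis by (simp add: FBET_def diff_count_def)
qed

text \<open>The vanishing sum makes opposite sides of the parallelogram \<open>x\<close>,
  \<open>x + a\<close>, \<open>x + a + b\<close>, \<open>x + b\<close> carry equal differences. This
  form is symmetric under exchanging \<open>(a, c)\<close> and \<open>(b, d)\<close>.\<close>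

lemma FBET_eq_derivative:
  "FBET F a c b (d::'a) =
     card {x. F x + F (x + a) = c \<and> F (x + b) + F (x + b + a) = c \<and>
              F x + F (x + b) = d \<and> F (x + a) + F (x + a + b) = d}"
proof -
  \<comment> \<open>\<open>p\<close>, \<open>q\<close>, \<open>r\<close>, \<open>s\<close> stand for
    the values of \<open>F\<close> at \<open>x\<close>, \<open>x + a\<close>, \<open>x + b\<close>,
    \<open>x + a + b\<close>.\<close>
  have *: "p + q + r + s = 0 \<and> p + q = c \<and> q + s = d \<longleftrightarrow>
    p + q = c \<and> r + s = c \<and> p + r = d \<and> q + s = d" for p q r s :: 'a
  proof -
    have "p + q + r + s = 0 \<longleftrightarrow> p + q = r + s"
      using add_eq_0_iff_eq[of "p + q" "r + s"] by (simp only: add.assoc)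
    moreover have "p + q + r + s = 0 \<longleftrightarrow> p + r = q + s"
      using add_eq_0_iff_eq[of "p + r" "q + s"] by (simp only: add_ac)
    ultimately show ?thesis by metis
  qed
  show ?thesis unfolding FBET_def * by (simp add: add_ac)
qed

section \<open>The power map and its derivative in direction one\<close>

lemma power_map_mult: "power_map m (x * y) = power_map m x * power_map m (y::'a)"
  by (simp add: power_map_def power_mult_distrib)

lemma power_map_0: "power_map m (0::'a) = 0"
proof -
  have "(2::nat) ^ (m + 1) - 1 > 0" using one_less_power[of "2::nat" "m + 1"] by simp
  thus ?thesis unfolding power_map_def by (rule zero_power)
qed

lemma power_map_1: "power_map m (1::'a) = 1"
  by (simp add: power_map_def)

text \<open>One more factor \<open>x\<close> turns the exponent into a power of two, and the map
  becomes additive.\<close>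

lemma power_map_mult_self: "power_map m x * x = (x::'a) ^ (2 ^ (m + 1))"
proof -
  have "Suc (2 ^ (m + 1) - 1) = 2 ^ (m + 1)" by simp
  thus ?thesis unfolding power_map_def by (metis power_Suc2)
qed

lemma power_map_derivative_scale:
  assumes "a \<noteq> (0::'a)"
  shows "power_map m x + power_map m (x + a) = c \<longleftrightarrow>
           power_map m (x / a) + power_map m (x / a + 1) = tq m a c"
proof -
  have factor: "power_map m x = power_map m a * power_map m (x / a)"
    "power_map m (x + a) = power_map m a * power_map m (x / a + 1)"
    using assms by (simp_all add: distrib_left flip: power_map_mult)
  moreover have "power_map m a \<noteq> 0" using assms by (simp add: power_map_def)
  moreover have "tq m a c = c / power_map m a" by (simp only: tq_def power_map_def)
  ultimately show ?thesis
    by (simp only: factor) (simp add: nonzero_eq_divide_eq distrib_left mult.commute)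
qed

lemma diff_count_power_map_scale:
  assumes "a \<noteq> (0::'a)"
  shows "diff_count (power_map m) a c = diff_count (power_map m) 1 (tq m a c)"
proof -
  have "bij_betw (\<lambda>x. x / a) {x. power_map m x + power_map m (x + a) = c}
          {y. power_map m y + power_map m (y + 1) = tq m a c}"
    using assms
    by (intro bij_betwI[where g = "\<lambda>y. y * a"]) (auto simp: power_map_derivative_scale[OF assms])
  thus ?thesis unfolding diff_count_def by (rule bij_betw_same_card)
qed

lemma power_map_derivative_iff:
  assumes "x \<noteq> 0" "x \<noteq> (1::'a)"
  shows "power_map m x + power_map m (x + 1) = t \<longleftrightarrow> x ^ (2 ^ (m + 1)) + x = t * (x\<^sup>2 + x)"
proof -
  let ?u = "power_map m x" and ?v = "power_map m (x + 1)"
  have nz: "x * (x + 1) \<noteq> 0" using assms by (simp add: add_eq_0_iff_eq)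
  have "(?u + ?v) * (x * (x + 1)) = (?u * x) * (x + 1) + (?v * (x + 1)) * x"
    by (simp add: algebra_simps)
  also have "\<dots> = x ^ (2 ^ (m + 1)) * (x + 1) + (x ^ (2 ^ (m + 1)) + 1) * x"
    unfolding power_map_mult_self frobenius_add by simp
  also have "\<dots> = x ^ (2 ^ (m + 1)) + x" by (simp add: distrib_left distrib_right mult.commute add_ac)
  finally have "(?u + ?v) * (x * (x + 1)) = x ^ (2 ^ (m + 1)) + x" .
  moreover have "x\<^sup>2 + x = x * (x + 1)" by (simp add: power2_eq_square distrib_left)
  ultimately show ?thesis using nz by (metis mult_cancel_right)
qed

text \<open>Clearing denominators loses \<open>0\<close> and \<open>1\<close>. At both of them the
  derivative has the value 1, so they return exactly for \<open>t = 1\<close>.\<close>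

lemma power_map_derivative_set:
  "{x::'a. power_map m x + power_map m (x + 1) = t} =
     {x. x \<noteq> 0 \<and> x \<noteq> 1 \<and> x ^ (2 ^ (m + 1)) + x = t * (x\<^sup>2 + x)} \<union> (if t = 1 then {0, 1} else {})"
proof -
  have "power_map m x + power_map m (x + 1) = t \<longleftrightarrow>
      x \<noteq> 0 \<and> x \<noteq> 1 \<and> x ^ (2 ^ (m + 1)) + x = t * (x\<^sup>2 + x) \<or> (x = 0 \<or> x = 1) \<and> t = 1" for x :: 'a
    by (cases "x = 0 \<or> x = 1") (auto simp: power_map_derivative_iff power_map_0 power_map_1)
  thus ?thesis by auto
qed

end


section \<open>Odd extension degree\<close>

locale odd_binary_field = binary_field n ty for n and ty :: "'a::finite_field itself" +
  fixes m :: nat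
  assumes odd_degree: "n = 2 * m + 1"
begin

text \<open>A square root of the squaring automorphism: \<open>2 * (m + 1) = n + 1\<close>, and the
  \<open>n\<close>-th Frobenius power is the identity.\<close>

definition root_frob :: "'a \<Rightarrow> 'a" where "root_frob x = x ^ (2 ^ (m + 1))"

lemma root_frob_add: "root_frob (x + y) = root_frob x + root_frob y"
  by (simp only: root_frob_def frobenius_add)

lemma root_frob_mult: "root_frob (x * y) = root_frob x * root_frob y"
  by (simp only: root_frob_def power_mult_distrib)

lemma root_frob_1: "root_frob 1 = 1" by (simp add: root_frob_def)

lemma root_frob_0: "root_frob 0 = 0" by (simp add: root_frob_def)

lemma root_frob_root_frob: "root_frob (root_frob x) = x\<^sup>2"
proof -
  have "(m + 1) + (m + 1) = Suc n" by (simp add: odd_degree)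
  hence "(2::nat) ^ (m + 1) * 2 ^ (m + 1) = 2 ^ n * 2" by (metis power_add power_Suc2)
  thus ?thesis
    unfolding root_frob_def by (metis frobenius_card power_mult)
qed

lemma root_frob_fixed: "root_frob x = x \<Longrightarrow> x = 0 \<or> x = 1"
  using root_frob_root_frob[of x] square_eq_self_iff[of x] by simp

lemma card_root_frob: "card {x. root_frob x + x = z} = (if abs_trace n z = 0 then 2 else 0)"
  unfolding root_frob_def
  by (rule card_artin_schreier) (use root_frob_fixed in \<open>simp add: root_frob_def\<close>)

lemma abs_trace_one: "abs_trace n (1::'a) = 1"
  by (simp add: abs_trace_def odd_degree)

text \<open>Expanding the product, \<open>w\<close> and its image under \<open>root_frob\<close>
  have equal traces and cancel, while 1 has trace 1 in odd degree. Applying \<open>root_frob\<close>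
  to the remaining product gives the square of \<open>w ^ (2 ^ m + 1)\<close>, with the same trace.
  For \<open>w = 1 / t\<close> this turns solvability into the trace condition of the
  theorem.\<close>

lemma abs_trace_norm_condition:
  "abs_trace n ((1 + w) * root_frob (1 + w)) = 0 \<longleftrightarrow> abs_trace n (w ^ (2 ^ m + 1)) = 1"
proof -
  have "root_frob (w * root_frob w) = root_frob w * w\<^sup>2"
    by (simp add: root_frob_mult root_frob_root_frob)
  also have "\<dots> = (w ^ (2 ^ m + 1)) ^ (2 ^ 1)"
    by (simp add: root_frob_def power_mult_distrib mult.commute flip: power_mult)
  finally have "abs_trace n (w * root_frob w) = abs_trace n (w ^ (2 ^ m + 1))"
    by (metis abs_trace_frobenius root_frob_def)
  moreover have "(1 + w) * root_frob (1 + w) = 1 + w + root_frob w + w * root_frob w"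
    by (simp add: root_frob_add root_frob_1 algebra_simps)
  moreover have "abs_trace n (root_frob w) = abs_trace n w"
    unfolding root_frob_def by (rule abs_trace_frobenius)
  ultimately have "abs_trace n ((1 + w) * root_frob (1 + w)) = 1 + abs_trace n (w ^ (2 ^ m + 1))"
    by (simp add: abs_trace_add abs_trace_one add.assoc)
  thus ?thesis by (auto simp: add_eq_0_iff_eq)
qed

text \<open>
  Put \<open>z = \<sigma> x + x\<close> with \<open>\<sigma> = root_frob\<close>. Since \<open>\<sigma> \<circ> \<sigma>\<close> is squaring, \<open>x\<^sup>2 + x = \<sigma> z + z\<close>, so the
  equation is the linear condition \<open>\<sigma> z = (1 + 1/t) z\<close>; applying \<open>\<sigma>\<close> once more gives \<open>z\<close> explicitly.
\<close>

lemma derivative_equation_solutions: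
  assumes "t \<noteq> 0" "t \<noteq> 1"
  shows "{x. x \<noteq> 0 \<and> x \<noteq> 1 \<and> root_frob x + x = t * (x\<^sup>2 + x)} =
           {x. root_frob x + x = (1 + 1 / t) * root_frob (1 + 1 / t)}"
proof -
  define r where "r = 1 + 1 / t"
  have tr: "t * r = t + 1" using assms by (simp add: r_def field_simps)
  have "r \<noteq> 0" using tr assms by (auto simp: add_eq_0_iff_eq)
  have sq: "x\<^sup>2 + x = root_frob (root_frob x + x) + (root_frob x + x)" for x
    by (simp add: root_frob_add root_frob_root_frob add_ac)
  have "x \<noteq> 0 \<and> x \<noteq> 1 \<and> root_frob x + x = t * (x\<^sup>2 + x) \<longleftrightarrow> root_frob x + x = r * root_frob r" for x
  proof -
    define z where "z = root_frob x + x"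
    have nz: "z \<noteq> 0 \<longleftrightarrow> x \<noteq> 0 \<and> x \<noteq> 1"
      using root_frob_fixed[of x]
      by (auto simp: z_def add_eq_0_iff_eq root_frob_0 root_frob_1)
    have lin: "z = t * (x\<^sup>2 + x) \<longleftrightarrow> root_frob z = r * z"
    proof -
      have "z = t * (x\<^sup>2 + x) \<longleftrightarrow> z = t * (root_frob z + z)" by (simp add: sq z_def)
      also have "\<dots> \<longleftrightarrow> z + t * z = t * root_frob z"
        by (subst add_eq_iff) (simp add: distrib_left add.commute)
      also have "\<dots> \<longleftrightarrow> t * (r * z) = t * root_frob z"
        by (simp add: tr distrib_right add.commute flip: mult.assoc)
      finally show ?thesis using assms by auto
    qed
    have "z \<noteq> 0 \<and> root_frob z = r * z \<longleftrightarrow> z = r * root_frob r"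
    proof (intro iffI conjI)
      assume *: "z \<noteq> 0 \<and> root_frob z = r * z"
      have "z\<^sup>2 = root_frob (r * z)" using * by (metis root_frob_root_frob)
      also have "\<dots> = r * root_frob r * z" using * by (simp add: root_frob_mult mult_ac)
      finally show "z = r * root_frob r" using * by (simp add: power2_eq_square)
    next
      assume *: "z = r * root_frob r"
      show "z \<noteq> 0" using * \<open>r \<noteq> 0\<close> by (simp add: root_frob_def)
      show "root_frob z = r * z"
        using * by (simp add: root_frob_mult root_frob_root_frob power2_eq_square mult_ac)
    qed
    thus ?thesis using nz lin by (auto simp: z_def)
  qed
  thus ?thesis by (simp add: r_def)
qed

lemma diff_count_odd:
  "diff_count (power_map m) 1 (t::'a) =
     (if t \<noteq> 0 \<and> abs_trace n (1 / t ^ (2 ^ m + 1)) = 1 then 2 else 0)"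
proof -
  let ?S = "{x. x \<noteq> 0 \<and> x \<noteq> 1 \<and> root_frob x + x = t * (x\<^sup>2 + x)}"
  have count: "diff_count (power_map m) 1 t = card (?S \<union> (if t = 1 then {0, 1} else {}))"
    by (simp only: diff_count_def power_map_derivative_set root_frob_def)
  consider "t = 0" | "t = 1" | "t \<noteq> 0" "t \<noteq> 1" by blast
  thus ?thesis
  proof cases
    case 1
    hence "?S = {}" using root_frob_fixed by (auto simp: add_eq_0_iff_eq)
    thus ?thesis using 1 count by simp
  next
    case 2
    have False if "x \<in> ?S" for x
    proof -
      have "root_frob x = x\<^sup>2" using that 2 by simp
      \<comment> \<open>For \<open>t = 1\<close> the equation becomes
        \<open>root_frob x = x^2\<close>; injectivity of \<open>root_frob\<close> then makes
        \<open>x\<close> a fixed point.\<close>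
      hence "root_frob x = root_frob (root_frob x)" by (metis root_frob_root_frob)
      hence "root_frob (root_frob x + x) = 0" by (metis root_frob_add add_self)
      hence "root_frob x = x" by (simp add: root_frob_def add_eq_0_iff_eq)
      thus False using that root_frob_fixed by auto
    qed
    hence "?S = {}" by blast
    \<comment> \<open>The solutions left are \<open>0\<close> and \<open>1\<close>, in agreement
      with the formula because 1 has trace 1.\<close>
    thus ?thesis using 2 count by (simp add: abs_trace_one)
  next
    case 3
    have "diff_count (power_map m) 1 t =
        card {x. root_frob x + x = (1 + 1 / t) * root_frob (1 + 1 / t)}"
      using 3 count by (simp add: derivative_equation_solutions)
    thus ?thesis
      using 3 by (simp add: card_root_frob abs_trace_norm_condition power_one_over)
  qed
qed

text \<open>In odd degree the map is almost perfect nonlinear: every derivative in a nonzero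
  direction takes each value at most twice. Three distinct solutions are already too many.\<close>

lemma FBET_odd_generic:
  assumes "a \<noteq> 0" "b \<noteq> 0" "a \<noteq> (b::'a)"
  shows "FBET (power_map m) a c b d = 0"
proof -
  let ?D = "{x. power_map m x + power_map m (x + a) = c}"
  have "x \<notin> ?D \<or> x + b \<notin> ?D" for x
  proof (rule ccontr)
    assume "\<not> ?thesis"
    hence "{x, x + a, x + b} \<subseteq> ?D" by (auto simp: add_ac)
    hence "card {x, x + a, x + b} \<le> card ?D" by (intro card_mono) auto
    moreover have "card {x, x + a, x + b} = 3" using assms by simp
    moreover have "card ?D \<le> 2"
      using diff_count_power_map_scale[OF assms(1)] diff_count_odd
      unfolding diff_count_def by simp
    ultimately show False by simp
  qed
  thus ?thesis by (auto simp: FBET_eq_derivative)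
qed

end


section \<open>Even extension degree\<close>

locale even_binary_field = binary_field n ty for n and ty :: "'a::finite_field itself" +
  fixes m :: nat
  assumes even_degree: "n = 2 * m"
begin

text \<open>Conjugation of the quadratic extension over the subfield of order \<open>2 ^ m\<close>:
  \<open>x + bar x\<close> is the relative trace and \<open>x * bar x\<close> the relative
  norm.\<close>

definition bar :: "'a \<Rightarrow> 'a" where "bar x = x ^ (2 ^ m)"

lemma bar_add: "bar (x + y) = bar x + bar y"
  by (simp only: bar_def frobenius_add)

lemma bar_mult: "bar (x * y) = bar x * bar y"
  by (simp only: bar_def power_mult_distrib)

lemma bar_divide: "bar (x / y) = bar x / bar y"
  by (simp only: bar_def power_divide)

lemma bar_power: "bar (x ^ k) = bar x ^ k"
  by (simp add: bar_def mult.commute flip: power_mult)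

lemma bar_1 [simp]: "bar 1 = 1" by (simp add: bar_def)

lemma bar_0 [simp]: "bar 0 = 0" by (simp add: bar_def)

lemma bar_bar [simp]: "bar (bar x) = x"
  unfolding bar_def
  by (metis even_degree frobenius_card mult_2 power_add power_mult)

lemma bar_eq_1_iff: "bar x = 1 \<longleftrightarrow> x = 1"
  by (metis bar_1 bar_bar)

text \<open>
  With \<open>e = x + bar x\<close> the equation reads \<open>e\<^sup>2 = (1 + t) (x\<^sup>2 + x)\<close>. Comparing with its conjugate
  determines \<open>e\<close>; the shift \<open>y = x + bar t / (1 + N)\<close>, \<open>N = t * bar t\<close>, then turns the system
  into \<open>y\<^sup>2 + y = v\<close>, \<open>y + bar y = 1\<close>.
\<close>

lemma derivative_equation_iff:
  "x ^ (2 ^ (m + 1)) + x = t * (x\<^sup>2 + x) \<longleftrightarrow> (x + bar x)\<^sup>2 = (1 + t) * (x\<^sup>2 + x)"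
proof -
  have "x ^ (2 ^ (m + 1)) = (bar x)\<^sup>2"
    by (simp add: bar_def mult.commute flip: power_mult)
  thus ?thesis
    by (simp add: square_add distrib_right add_eq_iff add_ac)
qed

text \<open>Eliminating \<open>x^2 + x\<close> between the equation and its conjugate leaves a
  multiple of \<open>e\<close>, and the other factor is linear in \<open>e\<close>. The form without
  division also serves norm one, where the left side vanishes.\<close>

lemma derivative_equation_trace:
  assumes "(x + bar x)\<^sup>2 = (1 + t) * (x\<^sup>2 + x)" and "x + bar x \<noteq> 0"
  shows "(1 + t * bar t) * (x + bar x) = (1 + t) * (1 + bar t)"
proof -
  define e where "e = x + bar x"
  have "e\<^sup>2 = bar (e\<^sup>2)" by (simp add: e_def bar_power bar_add add.commute)
  also have "\<dots> = (1 + bar t) * bar (x\<^sup>2 + x)"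
    using assms(1) by (simp add: e_def bar_mult bar_add)
  \<comment> \<open>Here \<open>bar x = x + e\<close>.\<close>
  also have "bar (x\<^sup>2 + x) = x\<^sup>2 + x + (e\<^sup>2 + e)"
    by (simp add: e_def square_add bar_add bar_power add_ac)
  finally have "(1 + t) * e\<^sup>2 = (1 + t) * ((1 + bar t) * (x\<^sup>2 + x + (e\<^sup>2 + e)))"
    by (rule arg_cong[where f = "\<lambda>w. (1 + t) * w"])
  also have "\<dots> = (1 + bar t) * ((1 + t) * (x\<^sup>2 + x) + (1 + t) * (e\<^sup>2 + e))"
    by (simp add: algebra_simps)
  also have "\<dots> = (1 + bar t) * (e\<^sup>2 + (1 + t) * (e\<^sup>2 + e))"
    by (simp only: assms(1) e_def)
  finally have "e * ((1 + t) * e) = e * ((1 + bar t) * (e + (1 + t) * (e + 1)))"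
    by (simp add: algebra_simps power2_eq_square)
  hence "(1 + t) * e = (1 + bar t) * (e + (1 + t) * (e + 1))"
    using assms(2) by (simp add: e_def)
  hence "(1 + t) * e + (1 + bar t) * (e + (1 + t) * (e + 1)) = 0"
    by simp
  hence "(1 + t * bar t) * e + (1 + t) * (1 + bar t) = 0"
    by (simp add: algebra_simps)
  thus ?thesis by (simp add: e_def add_eq_0_iff_eq)
qed

lemma derivative_equation_solutions:
  assumes "t \<noteq> 1" "t * bar t \<noteq> 1"
  defines "D \<equiv> 1 + t * bar t"
  shows "{x. x \<noteq> 0 \<and> x \<noteq> 1 \<and> x ^ (2 ^ (m + 1)) + x = t * (x\<^sup>2 + x)} =
           (\<lambda>y. y + bar t / D) ` {y. y\<^sup>2 + y = (bar t + t + 1) / D\<^sup>2 \<and> y + bar y = 1}"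
proof -
  have D0: "D \<noteq> 0" using assms by (auto simp: add_eq_0_iff_eq)
  have cD: "bar D = D" by (simp add: D_def bar_add bar_mult mult.commute)
  have t0: "1 + t \<noteq> 0" using assms(1) by (auto simp: add_eq_0_iff_eq)
  have ct0: "1 + bar t \<noteq> 0" using assms(1) bar_eq_1_iff[of t] by (auto simp: add_eq_0_iff_eq)
  \<comment> \<open>Since \<open>(1 + t) * (1 + bar t) = D + (t + bar t)\<close> and
    \<open>p + bar p = (t + bar t) / D\<close>, shifting by \<open>p\<close> normalises the relative
    trace to 1.\<close>
  define p where "p = bar t / D"
  have Dp: "D * p = bar t" using D0 by (simp add: p_def)
  \<comment> \<open>The right side comes from inserting \<open>e = (1 + t) * (1 + bar t) / D\<close>
    into \<open>e^2 = (1 + t) * (x^2 + x)\<close> and cancelling \<open>1 + t\<close>.\<close>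
  have shift: "D\<^sup>2 * ((y + p)\<^sup>2 + (y + p)) = (1 + t) * (1 + bar t)\<^sup>2 \<longleftrightarrow>
      y\<^sup>2 + y = (bar t + t + 1) / D\<^sup>2" for y
  proof -
    have "D\<^sup>2 * ((y + p)\<^sup>2 + (y + p)) = D\<^sup>2 * (y\<^sup>2 + y) + ((D * p)\<^sup>2 + D * (D * p))"
      by (simp add: square_add power_mult_distrib algebra_simps power2_eq_square)
    also have "\<dots> = D\<^sup>2 * (y\<^sup>2 + y) + ((bar t)\<^sup>2 + D * bar t)" by (simp only: Dp)
    finally have "D\<^sup>2 * ((y + p)\<^sup>2 + (y + p)) = (1 + t) * (1 + bar t)\<^sup>2 \<longleftrightarrow>
        D\<^sup>2 * (y\<^sup>2 + y) = ((bar t)\<^sup>2 + D * bar t) + (1 + t) * (1 + bar t)\<^sup>2"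
      by (simp add: add_eq_iff)
    also have "((bar t)\<^sup>2 + D * bar t) + (1 + t) * (1 + bar t)\<^sup>2 = bar t + t + 1"
      by (simp add: D_def square_add algebra_simps power2_eq_square)
    finally show ?thesis using D0 by (simp add: eq_divide_eq mult.commute)
  qed
  have trace: "D * ((y + p) + bar (y + p)) = (1 + t) * (1 + bar t) \<longleftrightarrow> y + bar y = 1" for y
  proof -
    have "D * bar p = t" using D0 by (simp add: p_def bar_divide cD)
    hence "D * ((y + p) + bar (y + p)) = D * (y + bar y) + (bar t + t)"
      using Dp by (simp add: bar_add algebra_simps)
    also have "\<dots> = (1 + t) * (1 + bar t) \<longleftrightarrow>
        D * (y + bar y) = (bar t + t) + (1 + t) * (1 + bar t)"
      by (simp add: add_eq_iff)
    also have "(bar t + t) + (1 + t) * (1 + bar t) = D * 1"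
      by (simp add: D_def algebra_simps)
    finally show ?thesis using D0 by simp
  qed
  have main: "x \<noteq> 0 \<and> x \<noteq> 1 \<and> (x + bar x)\<^sup>2 = (1 + t) * (x\<^sup>2 + x) \<longleftrightarrow>
      D\<^sup>2 * (x\<^sup>2 + x) = (1 + t) * (1 + bar t)\<^sup>2 \<and> D * (x + bar x) = (1 + t) * (1 + bar t)" for x
  proof -
    have A: "(x + bar x)\<^sup>2 = (1 + t) * (x\<^sup>2 + x) \<longleftrightarrow> D\<^sup>2 * (x\<^sup>2 + x) = (1 + t) * (1 + bar t)\<^sup>2"
      if "D * (x + bar x) = (1 + t) * (1 + bar t)"
    proof -
      have "(x + bar x)\<^sup>2 = (1 + t) * (x\<^sup>2 + x) \<longleftrightarrow>
          (D * (x + bar x))\<^sup>2 = D\<^sup>2 * ((1 + t) * (x\<^sup>2 + x))"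
        using D0 by (simp add: power_mult_distrib)
      also have "\<dots> \<longleftrightarrow> (1 + t) * ((1 + t) * (1 + bar t)\<^sup>2) = (1 + t) * (D\<^sup>2 * (x\<^sup>2 + x))"
        by (simp only: that) (simp add: power_mult_distrib power2_eq_square mult_ac)
      finally show ?thesis using t0 by auto
    qed
    have B: "x + bar x \<noteq> 0"
      if "x \<noteq> 0" "x \<noteq> 1" "(x + bar x)\<^sup>2 = (1 + t) * (x\<^sup>2 + x)"
    proof
      assume "x + bar x = 0"
      hence "(1 + t) * (x\<^sup>2 + x) = 0" using that by simp
      hence "x\<^sup>2 = x" using t0 by (simp add: add_eq_0_iff_eq)
      thus False using that by (simp add: square_eq_self_iff)
    qed
    have C: "x \<noteq> 0 \<and> x \<noteq> 1" if "D * (x + bar x) = (1 + t) * (1 + bar t)"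
      using that t0 ct0 by (metis add_self bar_0 bar_1 mult_eq_0_iff)
    show ?thesis using A B C derivative_equation_trace[of x t] by (auto simp: D_def)
  qed
  show ?thesis
  proof (rule Set.set_eqI)
    fix x
    let ?Y = "{y. y\<^sup>2 + y = (bar t + t + 1) / D\<^sup>2 \<and> y + bar y = 1}"
    have "x \<in> {x. x \<noteq> 0 \<and> x \<noteq> 1 \<and> x ^ (2 ^ (m + 1)) + x = t * (x\<^sup>2 + x)} \<longleftrightarrow> x + p \<in> ?Y"
      unfolding derivative_equation_iff mem_Collect_eq main shift[symmetric] trace[symmetric]
      by (simp add: add.assoc)
    also have "\<dots> \<longleftrightarrow> x \<in> (\<lambda>y. y + p) ` ?Y"
    proof
      assume "x + p \<in> ?Y"
      moreover have "x = (x + p) + p" by (simp add: add.assoc)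
      ultimately show "x \<in> (\<lambda>y. y + p) ` ?Y" by (rule rev_image_eqI)
    next
      assume "x \<in> (\<lambda>y. y + p) ` ?Y"
      then obtain y where "y \<in> ?Y" "x = y + p" by (rule imageE)
      moreover have "(y + p) + p = y" by (simp add: add.assoc)
      ultimately show "x + p \<in> ?Y" by (simp only:)
    qed
    finally show "x \<in> {x. x \<noteq> 0 \<and> x \<noteq> 1 \<and> x ^ (2 ^ (m + 1)) + x = t * (x\<^sup>2 + x)} \<longleftrightarrow>
        x \<in> (\<lambda>y. y + bar t / D) ` ?Y"
      by (simp only: p_def)
  qed
qed

text \<open>Telescoping gives every solution of \<open>y^2 + y = v\<close> the same relative trace
  \<open>abs_trace m v\<close>, so all or none qualify. If this value is 1, the trace of
  \<open>v\<close> over the full degree is \<open>1 + 1 = 0\<close>, and there are two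
  solutions.\<close>

lemma card_artin_schreier_bar:
  "card {y. y\<^sup>2 + y = v \<and> y + bar y = 1} = (if abs_trace m v = 1 then 2 else 0)"
proof -
  have tr: "y + bar y = abs_trace m v" if "y\<^sup>2 + y = v" for y
    using abs_trace_square_add_self[of m y] that by (simp add: bar_def add.commute)
  show ?thesis
  proof (cases "abs_trace m v = 1")
    case True
    hence "{y. y\<^sup>2 + y = v \<and> y + bar y = 1} = {y. y ^ (2 ^ 1) + y = v}"
      using tr by auto
    moreover have "abs_trace n v = 0"
      using True by (simp add: even_degree abs_trace_double)
    ultimately show ?thesis
      using True card_artin_schreier[of 1 v] by (simp add: square_eq_self_iff)
  next
    case False
    hence "{y. y\<^sup>2 + y = v \<and> y + bar y = 1} = {}" using tr by auto
    thus ?thesis using False by simp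
  qed
qed

text \<open>The exponent \<open>2 ^ (m + 1) + 2\<close> is twice that of the norm, so the
  denominator is the square of one plus the norm.\<close>

lemma even_trace_cond_iff:
  "even_trace_cond m t \<longleftrightarrow>
     t * bar t \<noteq> 1 \<and> abs_trace m ((bar t + t + 1) / (1 + t * bar t)\<^sup>2) = 1"
proof -
  have "t ^ (2 ^ m + 1) = t * bar t" by (simp add: bar_def)
  moreover have "t ^ (2 ^ (m + 1) + 2) = (t * bar t)\<^sup>2"
    by (simp add: bar_def power_add power_mult_distrib mult.commute flip: power_mult)
      (simp add: power2_eq_square)
  ultimately show ?thesis
    by (simp add: even_trace_cond_def square_add add.commute bar_def)
qed

text \<open>At \<open>t = 1\<close> the factor \<open>1 + t\<close> kills the right side, leaving
  \<open>(x + bar x)^2 = 0\<close>; the restored points \<open>0\<close> and \<open>1\<close>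
  satisfy this too.\<close>

lemma power_map_derivative_eq_1_iff:
  "power_map m x + power_map m (x + 1) = 1 \<longleftrightarrow> bar x = x"
proof -
  have "x \<in> {x. power_map m x + power_map m (x + 1) = 1} \<longleftrightarrow> x + bar x = 0"
    unfolding power_map_derivative_set derivative_equation_iff by auto
  thus ?thesis by (auto simp: add_eq_0_iff_eq)
qed

lemma diff_count_even:
  assumes "m > 0"
  shows "diff_count (power_map m) 1 (t::'a) =
     (if t = 1 then 2 ^ m else if even_trace_cond m t then 2 else 0)"
proof -
  let ?S = "{x. x \<noteq> 0 \<and> x \<noteq> 1 \<and> x ^ (2 ^ (m + 1)) + x = t * (x\<^sup>2 + x)}"
  consider "t = 1" | "t \<noteq> 1" "t * bar t = 1" | "t \<noteq> 1" "t * bar t \<noteq> 1" by blast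
  thus ?thesis
  proof cases
    case 1
    thus ?thesis
      using card_fixed_points[where 'a = 'a and m = m] assms card_field even_degree
      by (simp add: diff_count_def power_map_derivative_eq_1_iff bar_def)
  next
    case 2
    have False if "x \<in> ?S" for x
    proof -
      have x: "x \<noteq> 0" "x \<noteq> 1" and *: "(x + bar x)\<^sup>2 = (1 + t) * (x\<^sup>2 + x)"
        using that unfolding derivative_equation_iff by auto
      have t: "(1 + t) * (1 + bar t) \<noteq> 0"
        using 2 bar_eq_1_iff[of t] by (auto simp: add_eq_0_iff_eq)
      hence "x + bar x \<noteq> 0"
        using x * by (auto simp: add_eq_0_iff_eq square_eq_self_iff)
      \<comment> \<open>At norm one the trace relation would read
        \<open>0 = (1 + t) * (1 + bar t)\<close>.\<close>
      from derivative_equation_trace[OF * this] t 2 show False by auto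
    qed
    hence "?S = {}" by blast
    thus ?thesis
      using 2 unfolding diff_count_def power_map_derivative_set
      by (simp add: even_trace_cond_iff)
  next
    case 3
    let ?D = "1 + t * bar t"
    have "diff_count (power_map m) 1 t = card ?S"
      using 3 unfolding diff_count_def power_map_derivative_set by simp
    also have "\<dots> = card {y. y\<^sup>2 + y = (bar t + t + 1) / ?D\<^sup>2 \<and> y + bar y = 1}"
      unfolding derivative_equation_solutions[OF 3] by (intro card_image) (auto simp: inj_on_def)
    also have "\<dots> = (if even_trace_cond m t then 2 else 0)"
      using 3 by (simp add: card_artin_schreier_bar even_trace_cond_iff)
    finally show ?thesis using 3 by simp
  qed
qed

lemma power_map_derivative_tq_1:
  assumes "a \<noteq> 0" "tq m a c = 1"
  shows "power_map m x + power_map m (x + a) = c \<longleftrightarrow> bar (x / a) = x / a"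
  by (simp only: power_map_derivative_scale[OF assms(1)] assms(2) power_map_derivative_eq_1_iff)

text \<open>Only the normalised value 1 can be attained more than twice, and \<open>x\<close>,
  \<open>x + a\<close>, \<open>x + b\<close> are three distinct solutions.\<close>

lemma tq_eq_1_if_four_solutions:
  assumes "m > 0" "a \<noteq> 0" "b \<noteq> 0" "a \<noteq> (b::'a)"
    and "power_map m x + power_map m (x + a) = c"
    and "power_map m (x + b) + power_map m (x + b + a) = c"
  shows "tq m a c = 1"
proof (rule ccontr)
  assume "tq m a c \<noteq> 1"
  let ?D = "{x. power_map m x + power_map m (x + a) = c}"
  have "{x, x + a, x + b} \<subseteq> ?D" using assms by (auto simp: add_ac)
  hence "card {x, x + a, x + b} \<le> card ?D" by (intro card_mono) auto
  moreover have "card {x, x + a, x + b} = 3" using assms by simp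
  moreover have "card ?D \<le> 2"
    using diff_count_power_map_scale[OF assms(2)] diff_count_even[OF assms(1)] \<open>tq m a c \<noteq> 1\<close>
    unfolding diff_count_def by simp
  ultimately show False by simp
qed

text \<open>Let \<open>K\<close> be the fixed field of \<open>bar\<close>. Once both normalised
  values are 1, the conditions put \<open>x\<close> and \<open>x + b\<close> in \<open>a K\<close>,
  and \<open>x\<close> and \<open>x + a\<close> in \<open>b K\<close>. They are solvable only if
  \<open>a / b\<close> lies in \<open>K\<close>; then \<open>a K = b K\<close>, and all
  \<open>2 ^ m\<close> elements count.\<close>

lemma FBET_even_generic:
  assumes "m > 0" "a \<noteq> 0" "b \<noteq> 0" "a \<noteq> (b::'a)"
  shows "FBET (power_map m) a c b d =
     (if bar (a / b) = a / b \<and> tq m a c = 1 \<and> tq m b d = 1 then 2 ^ m else 0)"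
proof -
  let ?F = "power_map m :: 'a \<Rightarrow> 'a"
  let ?S = "{x. ?F x + ?F (x + a) = c \<and> ?F (x + b) + ?F (x + b + a) = c \<and>
                ?F x + ?F (x + b) = d \<and> ?F (x + a) + ?F (x + a + b) = d}"
  let ?P = "tq m a c = 1 \<and> tq m b d = 1"
  have P: ?P if "x \<in> ?S" for x
    \<comment> \<open>The second instance exchanges the roles of \<open>a\<close> and
      \<open>b\<close>.\<close>
    using that assms tq_eq_1_if_four_solutions[of a b x c] tq_eq_1_if_four_solutions[of b a x d]
    by auto
  have S: "x \<in> ?S \<longleftrightarrow> bar (x / a) = x / a \<and> bar (a / b) = a / b" if ?P for x
  proof -
    have "x \<in> ?S \<longleftrightarrow> bar (x / a) = x / a \<and> bar ((x + b) / a) = (x + b) / a \<and>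
        bar (x / b) = x / b \<and> bar ((x + a) / b) = (x + a) / b"
      using that assms by (simp add: power_map_derivative_tq_1)
    also have "\<dots> \<longleftrightarrow> bar (x / a) = x / a \<and> bar (b / a) = b / a \<and>
        bar (x / b) = x / b \<and> bar (a / b) = a / b"
      by (auto simp: add_divide_distrib bar_add)
    also have "\<dots> \<longleftrightarrow> bar (x / a) = x / a \<and> bar (a / b) = a / b"
    proof -
      have "b / a = 1 / (a / b)" "x / b = (x / a) * (a / b)" using assms by auto
      thus ?thesis by (metis bar_1 bar_divide bar_mult)
    qed
    finally show ?thesis .
  qed
  show ?thesis
  proof (cases "bar (a / b) = a / b \<and> ?P")
    case True
    hence "?S = {x. ?F x + ?F (x + a) = c}"
      using S power_map_derivative_tq_1[OF assms(2)] by blast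
    hence "FBET (power_map m) a c b d = diff_count (power_map m) 1 (1::'a)"
      using True diff_count_power_map_scale[OF assms(2), of m c]
      by (simp add: FBET_eq_derivative diff_count_def)
    thus ?thesis using True assms by (simp add: diff_count_even)
  next
    case False
    hence "?S = {}" using P S by blast
    thus ?thesis using False by (auto simp: FBET_eq_derivative)
  qed
qed

text \<open>At \<open>t = 0\<close> the trace is taken of 1, giving \<open>m\<close> modulo 2. This
  is the source of the parity conditions for \<open>c = 0\<close> or \<open>d = 0\<close>.\<close>

lemma even_trace_cond_0: "even_trace_cond m (0::'a) \<longleftrightarrow> odd m"
proof -
  have "(of_nat m :: 'a) = (if odd m then 1 else 0)"
    by (auto elim!: oddE evenE)
  thus ?thesis by (simp add: even_trace_cond_iff abs_trace_def)
qed

end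


section \<open>Assembly over the degenerate and generic directions\<close>

theorem theorem4:
  fixes m n :: nat and a c b d :: "'a::finite_field"
  assumes "m > 0"
    and "n \<in> {2 * m, 2 * m + 1}"
    and "CARD('a) = 2 ^ n"
  shows
    "(n = 2 * m + 1 \<longrightarrow>
       FBET (power_map m) a c b d =
         (if (a, c, b, d) \<in> I_zero then 2 ^ n
          else if (a, c, b, d) \<in> odd_I2_1 n m \<union> odd_I2_2 n m \<union> odd_I2_3 n m then 2
          else 0)) \<and>
     (n = 2 * m \<longrightarrow>
       FBET (power_map m) a c b d =
         (if (a, c, b, d) \<in> I_zero then 2 ^ n
          else if (a, c, b, d) \<in> even_Im_1 m \<union> even_Im_2 m \<union> even_Im_3 m \<union> even_Im_4 m then 2 ^ m
          else if (a, c, b, d) \<in> even_I2_1 m \<union> even_I2_2 m \<union> even_I2_3 m \<union>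
                                even_I2_4 m \<union> even_I2_5 m \<union> even_I2_6 m then 2
          else 0))"
proof -
  interpret binary_field n "TYPE('a)" by unfold_locales (rule assms(3))
  have tq0: "tq m x y = 0 \<longleftrightarrow> y = 0" if "x \<noteq> 0" for x y :: 'a
    using that by (simp add: tq_def)
  have zero: "diff_count (power_map m) 0 (y::'a) = (if y = 0 then 2 ^ n else 0)" for y
    using assms(3) by (simp add: diff_count_def)
  consider (0) "a = 0" "b = 0" | (a) "a = 0" "b \<noteq> 0" | (b) "a \<noteq> 0" "b = 0"
    | (ab) "a \<noteq> 0" "a = b" | (gen) "a \<noteq> 0" "b \<noteq> 0" "a \<noteq> b" by blast
  note cases = this
  show ?thesis
  proof (intro conjI impI)
    assume n: "n = 2 * m + 1"
    interpret odd_binary_field n "TYPE('a)" m by unfold_locales (rule n)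
    note sets = I_zero_def odd_I2_1_def odd_I2_2_def odd_I2_3_def
    have count: "diff_count (power_map m) x y =
        (if y \<noteq> 0 \<and> abs_trace n (1 / tq m x y ^ (2 ^ m + 1)) = 1 then 2 else 0)"
      if "x \<noteq> 0" for x y :: 'a
      by (simp only: diff_count_power_map_scale[OF that] diff_count_odd tq0[OF that])
    show "FBET (power_map m) a c b d =
        (if (a, c, b, d) \<in> I_zero then 2 ^ n
         else if (a, c, b, d) \<in> odd_I2_1 n m \<union> odd_I2_2 n m \<union> odd_I2_3 n m then 2
         else 0)"
    proof (cases rule: cases)
      case 0
      thus ?thesis by (simp add: sets FBET_zero_left zero)
    next
      case a
      thus ?thesis by (simp add: sets FBET_zero_left count)
    next
      case b
      thus ?thesis by (simp add: sets FBET_zero_right count)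
    next
      case ab
      thus ?thesis by (simp add: sets FBET_diag count)
    next
      case gen
      thus ?thesis by (simp add: sets FBET_odd_generic)
    qed
  next
    assume n: "n = 2 * m"
    interpret even_binary_field n "TYPE('a)" m by unfold_locales (rule n)
    have sub: "subfield_of_order (2 ^ m) = {x::'a. bar x = x}"
      unfolding bar_def using assms n by (intro subfield_of_order_eq) auto
    note sets = I_zero_def even_Im_1_def even_Im_2_def even_Im_3_def even_Im_4_def
      even_I2_1_def even_I2_2_def even_I2_3_def even_I2_4_def even_I2_5_def even_I2_6_def
    \<comment> \<open>The value \<open>y = 0\<close> is split off to match the sets of the theorem,
      which treat it by the parity of \<open>m\<close>.\<close>
    have count: "diff_count (power_map m) x y =
        (if y \<noteq> 0 \<and> tq m x y = 1 then 2 ^ m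
         else if y \<noteq> 0 \<and> even_trace_cond m (tq m x y) \<or> y = 0 \<and> odd m then 2 else 0)"
      if "x \<noteq> 0" for x y :: 'a
      using tq0[OF that, of y] even_trace_cond_0
      by (auto simp: diff_count_power_map_scale[OF that] diff_count_even[OF assms(1)])
    show "FBET (power_map m) a c b d =
        (if (a, c, b, d) \<in> I_zero then 2 ^ n
         else if (a, c, b, d) \<in> even_Im_1 m \<union> even_Im_2 m \<union> even_Im_3 m \<union> even_Im_4 m then 2 ^ m
         else if (a, c, b, d) \<in> even_I2_1 m \<union> even_I2_2 m \<union> even_I2_3 m \<union>
                               even_I2_4 m \<union> even_I2_5 m \<union> even_I2_6 m then 2
         else 0)"
    proof (cases rule: cases)
      case 0
      thus ?thesis by (simp add: sets FBET_zero_left zero)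
    next
      case a
      thus ?thesis by (simp add: sets FBET_zero_left count)
    next
      case b
      thus ?thesis by (simp add: sets FBET_zero_right count)
    next
      case ab
      thus ?thesis by (simp add: sets FBET_diag count)
    next
      case gen
      thus ?thesis using assms(1) by (simp add: sets sub FBET_even_generic)
    qed
  qed
qed

end
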